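(* Let $S$ be the set of consonant triads, let $P, L, R : S \to S$ be the parallel, leading tone exchange and relative functions, and let the $PLR$-group be the subgroup of the symmetric group $\mathrm{Sym}(S)$ generated by $P$, $L$ and $R$. Then the $PLR$-group is generated by $L$ and $R$, and it is dihedral of order $24$ (i.e., isomorphic to the dihedral group of order $24$).
   Context: For $n \in \mathbb{Z}_{12}$ (integers modulo 12), define $T_n, I_n : \mathbb{Z}_{12} \to \mathbb{Z}_{12}$ by $T_n(x) = x + n$ and $I_n(x) = -x + n$ (mod 12). These act componentwise on ordered triples: $T_n\langle y_1,y_2,y_3\rangle = \langle T_n(y_1),T_n(y_2),T_n(y_3)\rangle$ and $I_n\langle y_1,y_2,y_3\rangle = \langle I_n(y_1),I_n(y_2),I_n(y_3)\rangle$. The set $S$ of consonant triads (major and minor triads) is the set of 24 ordered triples in $\mathbb{Z}_{12}^3$ consisting of the 12 major triads $T_n\langle 0,4,7\rangle = \langle n, n+4, n+7\rangle$ and the 12 minor triads $I_n\langle 0,4,7\rangle = \langle n, n-4, n-7\rangle$, for $n \in \mathbb{Z}_{12}$. The functions $P, L, R : S \to S$ are defined by $$P\langle y_1,y_2,y_3\rangle = I_{y_1+y_3}\langle y_1,y_2,y_3\rangle,$$ $$L\langle y_1,y_2,y_3\rangle = I_{y_2+y_3}\langle y_1,y_2,y_3\rangle,$$ $$R\langle y_1,y_2,y_3\rangle = I_{y_1+y_2}\langle y_1,y_2,y_3\rangle,$$ where the inversions act componentwise; these are bijections of $S$. $\mathrm{Sym}(S)$ is the group of all bijections $S \to S$ under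 composition. The dihedral group of order 24 is the group of symmetries of a regular 12-gon; equivalently, the group generated by $s, t$ subject to the relations $s^{12} = 1$, $t^2 = 1$, $tst = s^{-1}$. *)

theory Defs
  imports
    "HOL-Analysis.Analysis"
    "HOL-Library.Numeral_Type"
    "HOL-Algebra.Generated_Groups"
    "HOL-Algebra.Bij"
begin

text \<open>The numeral type \<open>12\<close> of \<open>HOL-Library.Numeral_Type\<close> is the ring of integers modulo 12.\<close>

type_synonym pitch_class = "12"
type_synonym triad = "pitch_class \<times> pitch_class \<times> pitch_class"

definition pc_T :: "pitch_class \<Rightarrow> pitch_class \<Rightarrow> pitch_class" where
  "pc_T n x = x + n"

definition pc_I :: "pitch_class \<Rightarrow> pitch_class \<Rightarrow> pitch_class" where
  "pc_I n x = - x + n"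

definition map_triad :: "(pitch_class \<Rightarrow> pitch_class) \<Rightarrow> triad \<Rightarrow> triad" where
  "map_triad f = (\<lambda>(y1, y2, y3). (f y1, f y2, f y3))"

definition consonant_triads :: "triad set" where
  "consonant_triads =
     range (\<lambda>n. map_triad (pc_T n) (0, 4, 7)) \<union> range (\<lambda>n. map_triad (pc_I n) (0, 4, 7))"

text \<open>Elements of \<^const>\<open>BijGroup\<close> are extensional, so the three functions on the set of
  consonant triads are restricted to it (with value \<^const>\<open>undefined\<close> elsewhere).\<close>

definition P_triad :: "triad \<Rightarrow> triad" where
  "P_triad = restrict (\<lambda>(y1, y2, y3). map_triad (pc_I (y1 + y3)) (y1, y2, y3)) consonant_triads"

definition L_triad :: "triad \<Rightarrow> triad" where
  "L_triad = restrict (\<lambda>(y1, y2, y3). map_triad (pc_I (y2 + y3)) (y1, y2, y3)) consonant_triads"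

definition R_triad :: "triad \<Rightarrow> triad" where
  "R_triad = restrict (\<lambda>(y1, y2, y3). map_triad (pc_I (y1 + y2)) (y1, y2, y3)) consonant_triads"

definition Sym_triads :: "(triad \<Rightarrow> triad) monoid" where
  "Sym_triads = BijGroup consonant_triads"

definition PLR_group :: "(triad \<Rightarrow> triad) monoid" where
  "PLR_group = Sym_triads\<lparr>carrier := generate Sym_triads {P_triad, L_triad, R_triad}\<rparr>"

text \<open>For \<open>n \<ge> 3\<close>, the regular \<open>n\<close>-gon inscribed in the unit circle, and its group of
  symmetries, i.e. of the isometries of the plane that map the polygon onto itself.\<close>

definition regular_polygon :: "nat \<Rightarrow> complex set" where
  "regular_polygon n = convex hull ((\<lambda>k. cis (2 * pi * real k / real n)) ` {..<n})"

definition dihedral_group :: "nat \<Rightarrow> (complex \<Rightarrow> complex) monoid" where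
  "dihedral_group n = (BijGroup UNIV)
     \<lparr>carrier := {f \<in> Bij UNIV. (\<forall>x y. dist (f x) (f y) = dist x y) \<and>
                                 f ` regular_polygon n = regular_polygon n}\<rparr>"

text \<open>The generators do lie in the symmetric group, and the symmetries of a polygon do form a
  group.\<close>

lemma triad_inversion_in_Sym:
  fixes c :: "triad \<Rightarrow> pitch_class"
  assumes "f = restrict (\<lambda>y. map_triad (pc_I (c y)) y) consonant_triads"
    and mem: "\<And>y. y \<in> consonant_triads \<Longrightarrow> map_triad (pc_I (c y)) y \<in> consonant_triads"
    and c: "\<And>y. y \<in> consonant_triads \<Longrightarrow> c (map_triad (pc_I (c y)) y) = c y"
  shows "f \<in> carrier Sym_triads"
proof -
  have inv: "map_triad (pc_I n) (map_triad (pc_I n) y) = y" for n y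
    by (simp add: map_triad_def pc_I_def split: prod.splits)
  have "bij_betw f consonant_triads consonant_triads"
    by (rule bij_betw_byWitness[where f' = f]) (auto simp: assms(1) mem c inv)
  then show ?thesis
    by (simp add: Sym_triads_def BijGroup_def Bij_def assms(1))
qed

lemma consonant_triads_iff:
  "(a, b, c) \<in> consonant_triads \<longleftrightarrow>
     b = a + 4 \<and> c = a + 7 \<or> b = a - 4 \<and> c = a - 7"
  by (auto simp: consonant_triads_def map_triad_def pc_T_def pc_I_def image_iff algebra_simps)

lemma PLR_in_Sym:
  "P_triad \<in> carrier Sym_triads" "L_triad \<in> carrier Sym_triads" "R_triad \<in> carrier Sym_triads"
proof -
  show "P_triad \<in> carrier Sym_triads"
    by (rule triad_inversion_in_Sym[where c = "\<lambda>(y1, y2, y3). y1 + y3"])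
      (auto simp: P_triad_def consonant_triads_iff map_triad_def pc_I_def algebra_simps
         intro!: restrict_ext)
  show "L_triad \<in> carrier Sym_triads"
    by (rule triad_inversion_in_Sym[where c = "\<lambda>(y1, y2, y3). y2 + y3"])
      (auto simp: L_triad_def consonant_triads_iff map_triad_def pc_I_def algebra_simps
         intro!: restrict_ext)
  show "R_triad \<in> carrier Sym_triads"
    by (rule triad_inversion_in_Sym[where c = "\<lambda>(y1, y2, y3). y1 + y2"])
      (auto simp: R_triad_def consonant_triads_iff map_triad_def pc_I_def algebra_simps
         intro!: restrict_ext)
qed

lemma group_PLR_group: "group PLR_group"
proof -
  interpret group Sym_triads
    unfolding Sym_triads_def by (rule group_BijGroup)
  show ?thesis
    unfolding PLR_group_def
    by (rule subgroup_imp_group, rule generate_is_subgroup) (simp add: PLR_in_Sym)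
qed

lemma group_dihedral_group: "group (dihedral_group n)"
proof -
  let ?D = "{f \<in> Bij UNIV. (\<forall>x y. dist (f x) (f y) = dist x y) \<and>
               f ` regular_polygon n = regular_polygon n}"
  interpret group "BijGroup (UNIV :: complex set)"
    by (rule group_BijGroup)
  have "subgroup ?D (BijGroup UNIV)"
  proof (rule subgroupI)
    show "?D \<subseteq> carrier (BijGroup UNIV)"
      by (auto simp: BijGroup_def)
    show "?D \<noteq> {}"
      by (auto simp: Bij_def intro!: exI[of _ "\<lambda>x. x"] bij_id[unfolded id_def])
  next
    fix f assume f: "f \<in> ?D"
    then have b: "bij f" by (simp add: Bij_def)
    have i: "inv\<^bsub>BijGroup UNIV\<^esub> f = inv_into UNIV f"
      using inv_BijGroup[of f UNIV] f by (simp add: fun_eq_iff)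
    have "dist (inv_into UNIV f x) (inv_into UNIV f y) = dist x y" for x y
      proof -
      have "dist (f (inv_into UNIV f x)) (f (inv_into UNIV f y)) =
          dist (inv_into UNIV f x) (inv_into UNIV f y)"
        using f by blast
      then show ?thesis
        using b by (simp add: bij_is_surj surj_f_inv_f)
    qed
    moreover have "inv_into UNIV f ` regular_polygon n = regular_polygon n"
      proof -
      have "inv_into UNIV f ` (f ` regular_polygon n) = regular_polygon n"
        using b by (simp add: bij_is_inj image_inv_f_f)
      then show ?thesis
        using f by simp
    qed
    ultimately show "inv\<^bsub>BijGroup UNIV\<^esub> f \<in> ?D"
      using b by (simp add: i Bij_def bij_imp_bij_inv)
  next
    fix f g assume fg: "f \<in> ?D" "g \<in> ?D"
    have m: "f \<otimes>\<^bsub>BijGroup UNIV\<^esub> g = f \<circ> g"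
      using fg by (auto simp: BijGroup_def compose_def fun_eq_iff)
    show "f \<otimes>\<^bsub>BijGroup UNIV\<^esub> g \<in> ?D"
    proof -
      have "(f \<circ> g) ` regular_polygon n = f ` (g ` regular_polygon n)"
        by (simp only: image_comp)
      then have "(f \<circ> g) ` regular_polygon n = regular_polygon n"
        using fg by simp
      then show ?thesis
        using fg unfolding m by (simp add: Bij_def bij_comp)
    qed
  qed
  then show ?thesis
    unfolding dihedral_group_def by (rule subgroup_imp_group)
qed

end

theory Submission
  imports Defs "HOL-Algebra.Multiplicative_Group"
begin


text \<open>
  Both groups in question are generated by two involutions whose product has order 12, and such
  data determine a group up to isomorphism. Indeed, if \<open>s\<close> and \<open>t\<close> are involutions and
  \<open>r = t s\<close>, then \<open>s r s = s t = r\<^sup>-\<^sup>1\<close>, so every element of the generated group has the form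
  \<open>r\<^sup>i\<close> or \<open>r\<^sup>i s\<close>. The multiplication of these words is the same in every such group, and
  when \<open>r\<close> has order \<open>n > 2\<close>, two words coincide only if they have the same shape and their
  exponents agree modulo \<open>n\<close>. Hence there are \<open>2 n\<close> elements (\<open>card_generate\<close>), and sending
  a word to the word of the same shape is a well-defined isomorphism (\<open>involution_pairs_iso\<close>).

  On triads, take \<open>s = L\<close> and \<open>t = R\<close>. The product \<open>R L\<close> moves the major triads up and the
  minor triads down by a fifth, that is, by 7 semitones; as 7 is a unit modulo 12, its order is 12.
  The function \<open>P\<close> is the word \<open>(R L)\<^sup>4 L\<close>, so that \<open>L\<close> and \<open>R\<close> already generate the group.

  For the regular polygon, take \<open>s\<close> to be complex conjugation and \<open>t\<close> its composition with the
  rotation by \<open>2 \<pi> / n\<close>. That these generate all symmetries is the geometric part of the proof: a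
  symmetry permutes the extreme points of the polygon, which are the \<open>n\<close>-th roots of unity, and so
  fixes their centroid 0; an isometry of the plane fixing 0 is \<open>z \<mapsto> a z\<close> or
  \<open>z \<mapsto> a cnj z\<close>, where \<open>a\<close> is the image of the vertex 1
  (\<open>carrier_dihedral_group\<close>).
\<close>

section \<open>Groups generated by two involutions\<close>

locale involution_pair = group G for G (structure) +
  fixes s t n
  assumes s_closed [simp]: "s \<in> carrier G" and t_closed [simp]: "t \<in> carrier G"
    and s_s [simp]: "s \<otimes> s = \<one>" and t_t [simp]: "t \<otimes> t = \<one>"
    and ord_prod: "ord (t \<otimes> s) = n" and n_gt_2: "n > 2"
begin

text \<open>A pair \<open>(i, b)\<close> encodes the rotation \<open>(t s)\<^sup>i\<close>, followed on the right by the reflection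
  \<open>s\<close> if \<open>b\<close> holds. The encoding does not mention the group, so that words in different groups
  can be compared through their codes.\<close>

definition word :: "int \<times> bool \<Rightarrow> 'a" where
  "word = (\<lambda>(i, b). (t \<otimes> s) [^] i \<otimes> (if b then s else \<one>))"

lemma word_closed [simp]: "word p \<in> carrier G"
  by (simp add: word_def split: prod.splits)

text \<open>Conjugation by \<open>s\<close> is an endomorphism that inverts \<open>t s\<close>, hence inverts all its
  powers.\<close>

lemma s_conj_rotation:
  "s \<otimes> (t \<otimes> s) [^] (i::int) = (t \<otimes> s) [^] (- i) \<otimes> s"
proof -
  have hom: "(\<lambda>x. s \<otimes> x \<otimes> s) \<in> hom G G"
  proof (rule homI)
    fix x y assume xy: "x \<in> carrier G" "y \<in> carrier G"
    have "s \<otimes> x \<otimes> s \<otimes> (s \<otimes> y \<otimes> s) = s \<otimes> x \<otimes> (s \<otimes> s) \<otimes> y \<otimes> s"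
      using xy by (simp only: m_assoc m_closed s_closed)
    then show "s \<otimes> (x \<otimes> y) \<otimes> s = s \<otimes> x \<otimes> s \<otimes> (s \<otimes> y \<otimes> s)"
      using xy by (simp add: m_assoc)
  qed simp
  have inv_r: "s \<otimes> (t \<otimes> s) \<otimes> s = inv (t \<otimes> s)"
  proof -
    have "s \<otimes> (t \<otimes> s) \<otimes> s = s \<otimes> t \<otimes> (s \<otimes> s)"
      by (simp only: m_assoc m_closed s_closed t_closed)
    moreover have "inv (t \<otimes> s) = s \<otimes> t"
      by (rule inv_equality) (simp_all add: m_assoc, simp flip: m_assoc)
    ultimately show ?thesis
      by simp
  qed
  have "s \<otimes> (t \<otimes> s) [^] i \<otimes> s = inv (t \<otimes> s) [^] i"
    using hom_int_pow[OF hom, of "t \<otimes> s" i] inv_r is_group by simp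
  also have "\<dots> = (t \<otimes> s) [^] (- i)"
    by (simp add: int_pow_inv int_pow_neg)
  finally have "s \<otimes> (t \<otimes> s) [^] i \<otimes> s \<otimes> s = (t \<otimes> s) [^] (- i) \<otimes> s"
    by simp
  then show ?thesis
    by (simp add: m_assoc)
qed

lemma word_mult:
  "word (i, b) \<otimes> word (j, c) = word (if b then i - j else i + j, b \<noteq> c)"
proof (cases b)
  case True
  let ?r = "t \<otimes> s" and ?e = "if c then s else \<one>"
  have "word (i, b) \<otimes> word (j, c) = ?r [^] i \<otimes> (s \<otimes> ?r [^] j) \<otimes> ?e"
    using True by (simp add: word_def m_assoc)
  also have "\<dots> = ?r [^] i \<otimes> (?r [^] (- j) \<otimes> s) \<otimes> ?e"
    by (simp only: s_conj_rotation)
  also have "\<dots> = ?r [^] (i - j) \<otimes> (s \<otimes> ?e)"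
    using int_pow_mult[of ?r i "- j"] by (simp add: m_assoc)
  finally show ?thesis
    using True by (simp add: word_def)
next
  case False
  then show ?thesis
    by (simp add: word_def int_pow_mult m_assoc)
qed

text \<open>The substance is that \<open>s\<close> is not a power of \<open>t s\<close>: otherwise it would commute with
  \<open>t s\<close>, while it also inverts it, and then the order of \<open>t s\<close> would divide 2.\<close>

lemma word_eq_iff: "word (i, b) = word (j, c) \<longleftrightarrow> b = c \<and> int n dvd i - j"
proof -
  let ?r = "t \<otimes> s"
  have eq: "?r [^] i = ?r [^] j \<longleftrightarrow> int n dvd i - j" for i j :: int
    using ord_prod int_pow_eq[of ?r j i] by (auto simp: eq_commute)
  have no_reflection: "?r [^] i \<noteq> ?r [^] j \<otimes> s" for i j :: int
  proof
    assume "?r [^] i = ?r [^] j \<otimes> s"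
    then have "word (- j, False) \<otimes> word (i, False) = word (- j, False) \<otimes> word (j, True)"
      by (simp add: word_def)
    then have s: "s = ?r [^] (i - j)"
      unfolding word_mult by (simp add: word_def)
    have "?r [^] (-1 :: int) = s \<otimes> ?r [^] (1 :: int) \<otimes> s"
      by (simp only: s_conj_rotation) (simp add: m_assoc)
    also have "s \<otimes> ?r [^] (1 :: int) = ?r [^] (1 :: int) \<otimes> s"
    proof -
      have "?r [^] (i - j) \<otimes> ?r [^] (1 :: int) = ?r [^] (1 :: int) \<otimes> ?r [^] (i - j)"
        by (simp only: int_pow_mult [symmetric] m_closed s_closed t_closed add.commute)
      then show ?thesis
        by (simp only: s [symmetric])
    qed
    finally have "?r [^] (-1 :: int) = ?r [^] (1 :: int)"
      by (simp add: m_assoc)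
    then have "int n dvd -2"
      by (simp only: eq) simp
    then show False
      using n_gt_2 zdvd_imp_le[of "int n" 2] by simp
  qed
  show ?thesis
    using no_reflection[of i j] no_reflection[of j i] by (auto simp: word_def eq)
qed

lemma subgroup_words: "subgroup (range word) G"
proof (rule subgroupI)
  show "inv a \<in> range word" if mem: "a \<in> range word" for a
  proof -
    obtain i b where a: "a = word (i, b)"
      using mem by (elim rangeE) (metis surj_pair)
    have "word (if b then i else - i, b) \<otimes> a = word (0, False)"
      by (simp add: a word_mult)
    then have "inv a = word (if b then i else - i, b)"
      by (simp add: a word_def inv_equality)
    then show ?thesis by simp
  qed
  show "a \<otimes> b \<in> range word" if "a \<in> range word" "b \<in> range word" for a b
    using that by (auto simp: word_mult)
qed auto

lemma generate_eq_words: "generate G {s, t} = range word"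
proof
  have "s = word (0, True)" "t = word (1, True)"
    by (simp_all add: word_def m_assoc)
  then have "{s, t} \<subseteq> range word"
    by blast
  then show "generate G {s, t} \<subseteq> range word"
    by (rule generate_subgroup_incl) (rule subgroup_words)
next
  have gen: "subgroup (generate G {s, t}) G"
    by (rule generate_is_subgroup) simp
  have s: "s \<in> generate G {s, t}"
    by (simp add: generate.incl)
  then have r: "t \<otimes> s \<in> generate G {s, t}"
    by (simp add: generate.eng generate.incl)
  have "word (i, b) \<in> generate G {s, t}" for i b
    unfolding word_def prod.case
    by (rule subgroup.m_closed[OF gen]) (simp_all add: s subgroup_int_pow_closed[OF gen r] generate.one)
  then show "range word \<subseteq> generate G {s, t}"
    by auto
qed

lemma card_generate: "card (generate G {s, t}) = 2 * n"
proof -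
  have "range word \<subseteq> word ` ({0..<int n} \<times> UNIV)"
  proof clarify
    fix i b
    have "word (i, b) = word (i mod int n, b)"
      by (simp add: word_eq_iff)
    then show "word (i, b) \<in> word ` ({0..<int n} \<times> UNIV)"
      using n_gt_2 by auto
  qed
  then have "range word = word ` ({0..<int n} \<times> UNIV)"
    by auto
  moreover have "inj_on word ({0..<int n} \<times> UNIV)"
  proof (rule inj_onI, clarify)
    fix i j b c
    assume "i \<in> {0..<int n}" "j \<in> {0..<int n}" "word (i, b) = word (j, c)"
    then have "i mod int n = j mod int n" "b = c"
      by (simp_all only: word_eq_iff mod_eq_dvd_iff)
    then show "i = j \<and> b = c"
      using \<open>i \<in> _\<close> \<open>j \<in> _\<close> mod_pos_pos_trivial[of i "int n"] mod_pos_pos_trivial[of j "int n"]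
      by (metis atLeastLessThan_iff)
  qed
  ultimately show ?thesis
    by (simp add: generate_eq_words card_image card_cartesian_product)
qed

end

text \<open>Words multiply by the same rule, and coincide under the same condition, in both groups;
  therefore the map that keeps the code of a word is well defined, injective and multiplicative.\<close>

lemma involution_pairs_iso:
  assumes G: "involution_pair G s t n" and H: "involution_pair H s' t' n"
  shows "G\<lparr>carrier := generate G {s, t}\<rparr> \<cong> H\<lparr>carrier := generate H {s', t'}\<rparr>"
proof -
  interpret A: involution_pair G s t n by (fact G)
  interpret B: involution_pair H s' t' n by (fact H)
  \<comment> \<open>The choice of a code for \<open>x\<close> does not matter, which is what the fact \<open>h\<close> records.\<close>
  define h where "h x = B.word (SOME p. A.word p = x)" for x
  have h: "h (A.word p) = B.word p" for p
  proof -
    have "A.word (SOME q. A.word q = A.word p) = A.word p"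
      by (rule someI) simp
    then show ?thesis
      unfolding h_def by (cases p, cases "SOME q. A.word q = A.word p")
        (simp add: A.word_eq_iff B.word_eq_iff)
  qed
  have "h \<in> hom (G\<lparr>carrier := range A.word\<rparr>) (H\<lparr>carrier := range B.word\<rparr>)"
    by (rule homI) (auto simp: h A.word_mult B.word_mult)
  moreover have "inj_on h (range A.word)"
    by (rule inj_onI) (auto simp: h A.word_eq_iff B.word_eq_iff)
  moreover have "h ` range A.word = range B.word"
    by (simp add: image_image h)
  ultimately have "h \<in> iso (G\<lparr>carrier := range A.word\<rparr>) (H\<lparr>carrier := range B.word\<rparr>)"
    by (simp add: iso_def bij_betw_def)
  then show ?thesis
    unfolding A.generate_eq_words B.generate_eq_words by (rule is_isoI)
qed

section \<open>Groups of bijections\<close>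

lemma BijGroup_carrier: "carrier (BijGroup S) = Bij S"
  by (simp add: BijGroup_def)

lemma BijGroup_mult_apply:
  assumes "f \<in> Bij S" "g \<in> Bij S" "x \<in> S"
  shows "(f \<otimes>\<^bsub>BijGroup S\<^esub> g) x = f (g x)"
  using assms by (simp add: BijGroup_def compose_eq)

lemma BijGroup_one_apply: "x \<in> S \<Longrightarrow> \<one>\<^bsub>BijGroup S\<^esub> x = x"
  by (simp add: BijGroup_def)

lemma BijGroup_pow_apply:
  assumes f: "f \<in> Bij S" and x: "x \<in> S"
  shows "(f [^]\<^bsub>BijGroup S\<^esub> (k::nat)) x = (f ^^ k) x"
  using x
proof (induction k arbitrary: x)
  case 0
  then show ?case by (simp add: BijGroup_one_apply)
next
  case (Suc k)
  interpret group "BijGroup S" by (rule group_BijGroup)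
  have "f [^]\<^bsub>BijGroup S\<^esub> k \<in> Bij S"
    using nat_pow_closed[of f k] f by (simp add: BijGroup_carrier)
  moreover have "f x \<in> S"
    using f Suc.prems by (auto simp: Bij_def bij_betw_def)
  ultimately show ?case
    using f Suc by (simp add: BijGroup_mult_apply funpow_Suc_right del: funpow.simps(2))
qed

lemma BijGroup_eqI:
  assumes "f \<in> carrier (BijGroup S)" "g \<in> carrier (BijGroup S)" "\<And>x. x \<in> S \<Longrightarrow> f x = g x"
  shows "f = g"
  using assms by (intro extensionalityI[of f S g]) (auto simp: BijGroup_carrier Bij_def)

section \<open>The leading tone exchange and the relative\<close>

text \<open>The parameter is the first entry of the triad. For a minor triad this is the fifth of the
  chord, not its root: \<open>minor 7\<close> is C minor.\<close>

definition major :: "pitch_class \<Rightarrow> triad" where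
  "major a = (a, a + 4, a + 7)"

definition minor :: "pitch_class \<Rightarrow> triad" where
  "minor a = (a, a - 4, a - 7)"

lemma consonant_triads_eq: "consonant_triads = range major \<union> range minor"
  by (auto simp: major_def minor_def consonant_triads_iff)

lemma major_minor_consonant [simp]:
  "major a \<in> consonant_triads" "minor a \<in> consonant_triads"
  by (simp_all add: consonant_triads_eq)

lemma triad_functions_major_minor:
  "P_triad (major a) = minor (a + 7)" "P_triad (minor a) = major (a - 7)"
  "L_triad (major a) = minor (a + 11)" "L_triad (minor a) = major (a - 11)"
  "R_triad (major a) = minor (a + 4)" "R_triad (minor a) = major (a - 4)"
  by (simp_all add: P_triad_def L_triad_def R_triad_def
      major_def minor_def consonant_triads_iff map_triad_def pc_I_def algebra_simps)

text \<open>A single application of \<open>R L\<close> transposes the major triads by 7 and the minor triads by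
  \<open>- 7\<close>.\<close>

lemma R_L_power:
  "((R_triad \<otimes>\<^bsub>Sym_triads\<^esub> L_triad) [^]\<^bsub>Sym_triads\<^esub> k) (major a) = major (a + 7 * of_nat k)"
  "((R_triad \<otimes>\<^bsub>Sym_triads\<^esub> L_triad) [^]\<^bsub>Sym_triads\<^esub> k) (minor a) = minor (a - 7 * of_nat k)"
  for k :: nat
proof -
  let ?r = "R_triad \<otimes>\<^bsub>Sym_triads\<^esub> L_triad"
  interpret group Sym_triads
    unfolding Sym_triads_def by (rule group_BijGroup)
  have mem: "L_triad \<in> Bij consonant_triads" "R_triad \<in> Bij consonant_triads"
      "?r \<in> Bij consonant_triads"
    using PLR_in_Sym m_closed[of R_triad L_triad] by (simp_all add: Sym_triads_def BijGroup_carrier)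
  have step: "?r (major a) = major (a + 7)" "?r (minor a) = minor (a - 7)" for a
    using mem by (simp_all add: Sym_triads_def BijGroup_mult_apply triad_functions_major_minor
        algebra_simps)
  have "(?r ^^ k) (major a) = major (a + 7 * of_nat k)"
    by (induction k) (simp_all add: step algebra_simps)
  moreover have "(?r ^^ k) (minor a) = minor (a - 7 * of_nat k)"
    by (induction k) (simp_all add: step algebra_simps)
  ultimately show
    "(?r [^]\<^bsub>Sym_triads\<^esub> k) (major a) = major (a + 7 * of_nat k)"
    "(?r [^]\<^bsub>Sym_triads\<^esub> k) (minor a) = minor (a - 7 * of_nat k)"
    using mem BijGroup_pow_apply[of ?r consonant_triads _ k] by (simp_all add: Sym_triads_def)
qed

text \<open>The order of \<open>R L\<close> is read off from its powers: \<open>7 k = 0\<close> modulo 12 exactly when 12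
  divides \<open>k\<close>.\<close>

lemma involution_pair_L_R: "involution_pair Sym_triads L_triad R_triad 12"
proof -
  let ?r = "R_triad \<otimes>\<^bsub>Sym_triads\<^esub> L_triad"
  interpret group Sym_triads
    unfolding Sym_triads_def by (rule group_BijGroup)
  have triad_eqI: "f = g"
    if "f \<in> carrier Sym_triads" "g \<in> carrier Sym_triads"
      "\<And>a. f (major a) = g (major a)" "\<And>a. f (minor a) = g (minor a)" for f g
  proof (rule BijGroup_eqI[of f consonant_triads g])
    show "f x = g x" if "x \<in> consonant_triads" for x
      using that \<open>\<And>a. f (major a) = _\<close> \<open>\<And>a. f (minor a) = _\<close>
      by (auto simp del: split_paired_All simp: consonant_triads_eq)
  qed (use that in \<open>simp_all add: Sym_triads_def\<close>)
  have mult_apply: "(f \<otimes>\<^bsub>Sym_triads\<^esub> g) x = f (g x)"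
    if "f \<in> carrier Sym_triads" "g \<in> carrier Sym_triads" "x \<in> consonant_triads" for f g x
    using that by (simp add: Sym_triads_def BijGroup_mult_apply BijGroup_carrier)
  have one_apply: "\<one>\<^bsub>Sym_triads\<^esub> x = x" if "x \<in> consonant_triads" for x
    using that by (simp add: Sym_triads_def BijGroup_one_apply)
  have "?r [^]\<^bsub>Sym_triads\<^esub> k = \<one>\<^bsub>Sym_triads\<^esub> \<longleftrightarrow> 12 dvd k" for k :: nat
  proof
    assume "?r [^]\<^bsub>Sym_triads\<^esub> k = \<one>\<^bsub>Sym_triads\<^esub>"
    then have "major (0 + 7 * of_nat k) = major 0"
      using R_L_power(1)[of k 0] one_apply by simp
    then have "7 * (7 * of_nat k) = (0 :: pitch_class)"
      by (simp add: major_def)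
    \<comment> \<open>7 is its own inverse modulo 12.\<close>
    moreover have "7 * (7 * of_nat k) = (49 :: pitch_class) * of_nat k"
      by simp
    moreover have "(49 :: pitch_class) = 1"
      by simp
    ultimately have "(of_nat k :: pitch_class) = 0"
      by (metis mult_1)
    then show "12 dvd k"
      by (simp add: of_nat_eq_0_iff_char_dvd)
  next
    assume "12 dvd k"
    then have "(of_nat k :: pitch_class) = 0"
      by (simp add: of_nat_eq_0_iff_char_dvd)
    then show "?r [^]\<^bsub>Sym_triads\<^esub> k = \<one>\<^bsub>Sym_triads\<^esub>"
      by (intro triad_eqI) (simp_all add: PLR_in_Sym R_L_power one_apply)
  qed
  then have "ord ?r = 12"
    by (subst ord_unique) (simp_all add: PLR_in_Sym)
  moreover have "L_triad \<otimes>\<^bsub>Sym_triads\<^esub> L_triad = \<one>\<^bsub>Sym_triads\<^esub>"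
    "R_triad \<otimes>\<^bsub>Sym_triads\<^esub> R_triad = \<one>\<^bsub>Sym_triads\<^esub>"
    by (intro triad_eqI;
        simp add: PLR_in_Sym mult_apply one_apply triad_functions_major_minor)+
  ultimately show ?thesis
    by unfold_locales (simp_all add: PLR_in_Sym)
qed

text \<open>\<open>L\<close> sends \<open>major a\<close> to \<open>minor (a + 11)\<close>, and \<open>P\<close> sends it to \<open>minor (a + 7)\<close>; the
  exponent 4 is the solution of \<open>11 - 7 k = 7\<close> modulo 12.\<close>

lemma P_eq_word:
  "P_triad = (R_triad \<otimes>\<^bsub>Sym_triads\<^esub> L_triad) [^]\<^bsub>Sym_triads\<^esub> (4::nat) \<otimes>\<^bsub>Sym_triads\<^esub> L_triad"
  (is "_ = ?r [^]\<^bsub>Sym_triads\<^esub> _ \<otimes>\<^bsub>Sym_triads\<^esub> _")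
proof -
  interpret group Sym_triads
    unfolding Sym_triads_def by (rule group_BijGroup)
  have r4: "?r [^]\<^bsub>Sym_triads\<^esub> (4::nat) \<in> Bij consonant_triads"
    using nat_pow_closed[OF m_closed[OF PLR_in_Sym(3,2)], of 4]
    by (simp add: Sym_triads_def BijGroup_carrier)
  have L: "L_triad \<in> Bij consonant_triads"
    using PLR_in_Sym by (simp add: Sym_triads_def BijGroup_carrier)
  \<comment> \<open>Both equations say that 24 vanishes modulo 12.\<close>
  have shift: "a + 7 = a - 17" "a - 7 = 17 + a" for a :: pitch_class
    by (simp_all add: eq_diff_eq diff_eq_eq)
  have mult: "(?r [^]\<^bsub>Sym_triads\<^esub> (4::nat) \<otimes>\<^bsub>Sym_triads\<^esub> L_triad) x
      = (?r [^]\<^bsub>Sym_triads\<^esub> (4::nat)) (L_triad x)" if "x \<in> consonant_triads" for x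
    using BijGroup_mult_apply[OF r4 L that] by (simp add: Sym_triads_def)
  show ?thesis
  proof (rule BijGroup_eqI[where S = consonant_triads])
    show "P_triad \<in> carrier (BijGroup consonant_triads)"
      using PLR_in_Sym by (simp add: Sym_triads_def)
    show "?r [^]\<^bsub>Sym_triads\<^esub> (4::nat) \<otimes>\<^bsub>Sym_triads\<^esub> L_triad \<in> carrier (BijGroup consonant_triads)"
      using PLR_in_Sym m_closed nat_pow_closed unfolding Sym_triads_def by blast
    show "P_triad x = (?r [^]\<^bsub>Sym_triads\<^esub> (4::nat) \<otimes>\<^bsub>Sym_triads\<^esub> L_triad) x"
      if x: "x \<in> consonant_triads" for x
    proof -
      consider a where "x = major a" | a where "x = minor a"
        using x by (auto simp: consonant_triads_eq)
      then show ?thesis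
        by cases (simp_all add: mult R_L_power triad_functions_major_minor shift)
    qed
  qed
qed

lemma PLR_generate_eq:
  "generate Sym_triads {P_triad, L_triad, R_triad} = generate Sym_triads {L_triad, R_triad}"
proof
  interpret involution_pair Sym_triads L_triad R_triad 12
    by (rule involution_pair_L_R)
  have "P_triad = word (4, True)"
    using P_eq_word by (simp add: word_def flip: int_pow_int)
  then have "P_triad \<in> generate Sym_triads {L_triad, R_triad}"
    by (simp add: generate_eq_words)
  then have "{P_triad, L_triad, R_triad} \<subseteq> generate Sym_triads {L_triad, R_triad}"
    by (auto intro: generate.incl)
  then show "generate Sym_triads {P_triad, L_triad, R_triad} \<subseteq> generate Sym_triads {L_triad, R_triad}"
    by (rule generate_subgroup_incl) (simp add: generate_is_subgroup)
  show "generate Sym_triads {L_triad, R_triad} \<subseteq> generate Sym_triads {P_triad, L_triad, R_triad}"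
    by (rule mono_generate) blast
qed

section \<open>The symmetries of a regular polygon\<close>

text \<open>Betweenness in a Euclidean space is a metric notion (equality in the triangle inequality),
  so an isometry preserves open segments, and with them extreme points, before anything is known
  about its linearity.\<close>

lemma isometry_extreme_point:
  fixes f :: "'a::euclidean_space \<Rightarrow> 'a"
  assumes iso: "\<And>x y. dist (f x) (f y) = dist x y" and v: "v extreme_point_of S"
  shows "f v extreme_point_of f ` S"
proof -
  have seg: "f x \<in> open_segment (f a) (f b) \<longleftrightarrow> x \<in> open_segment a b" for x a b
  proof -
    have "x = y \<longleftrightarrow> f x = f y" for x y
      by (metis iso dist_eq_0_iff)
    then show ?thesis
      by (auto simp: open_segment_def between iso simp flip: between_mem_segment)
  qed
  then show ?thesis
    using v by (auto simp: extreme_point_of_def)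
qed

lemma regular_polygon_eq:
  "n > 0 \<Longrightarrow> regular_polygon n = convex hull {z. z ^ n = 1}"
  using Complex.bij_betw_roots_unity[of n] by (simp add: regular_polygon_def bij_betw_def)

text \<open>A root of unity lies on the unit circle, whereas the polygon lies in the closed unit disc;
  by strict convexity of the disc, no open segment of the polygon passes through it.\<close>

lemma extreme_points_regular_polygon:
  assumes n: "n > 0"
  shows "{v. v extreme_point_of regular_polygon n} = {z. z ^ n = 1}"
proof
  show "{v. v extreme_point_of regular_polygon n} \<subseteq> {z. z ^ n = 1}"
    unfolding regular_polygon_eq[OF n] by (rule extreme_points_of_convex_hull)
next
  have norm_root: "norm z = 1" if "z ^ n = 1" for z :: complex
    using that n by (metis norm_one norm_power norm_ge_zero power_eq_1_iff less_not_refl)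
  then have ball: "regular_polygon n \<subseteq> cball 0 1"
    unfolding regular_polygon_eq[OF n] by (intro hull_minimal) auto
  show "{z. z ^ n = 1} \<subseteq> {v. v extreme_point_of regular_polygon n}"
  proof clarify
    fix z :: complex assume z: "z ^ n = 1"
    have "z \<notin> open_segment a b" if "a \<in> regular_polygon n" "b \<in> regular_polygon n" for a b
      using dist_decreases_open_segment[of z a b 0] norm_root[OF z] that ball
      by (auto simp: dist_norm) (smt (verit) mem_cball_0 subset_iff)+
    then show "z extreme_point_of regular_polygon n"
      using z n by (auto simp: extreme_point_of_def regular_polygon_eq hull_inc)
  qed
qed

text \<open>Such an isometry is linear, hence determined by its values at 1 and \<open>\<i>\<close>. The quotient
  \<open>u\<close> of these values has the same distances from 0 and 1 as \<open>\<i>\<close>, which leaves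
  \<open>u = \<i>\<close> and \<open>u = - \<i>\<close>.\<close>

lemma isometry_eq_rotation_or_reflection:
  fixes f :: "complex \<Rightarrow> complex"
  assumes f0: "f 0 = 0" and iso: "\<And>x y. dist (f x) (f y) = dist x y"
  shows "f = (\<lambda>z. f 1 * z) \<or> f = (\<lambda>z. f 1 * cnj z)"
proof -
  have lin: "linear f"
    using f0 iso by (intro isometry_linear) auto
  have n1: "norm (f 1) = 1" and ni: "norm (f \<i>) = 1"
    using iso[of 1 0] iso[of \<i> 0] by (simp_all add: f0 dist_norm)
  define u where "u = f \<i> / f 1"
  have f1: "f 1 \<noteq> 0" using n1 by auto
  have "norm u = 1"
    by (simp add: u_def norm_divide n1 ni)
  moreover have "norm (u - 1) = sqrt 2"
  proof -
    have "norm (u - 1) = norm (f \<i> - f 1) / norm (f 1)"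
      using f1 by (simp add: u_def diff_divide_distrib flip: norm_divide)
    also have "\<dots> = norm (\<i> - 1)"
      using iso[of \<i> 1] by (simp add: n1 dist_norm)
    finally show ?thesis by (simp add: cmod_def)
  qed
  ultimately have "(Re u)\<^sup>2 + (Im u)\<^sup>2 = 1" "(Re u - 1)\<^sup>2 + (Im u)\<^sup>2 = 2"
    by (simp_all add: cmod_def)
  then have "Re u = 0" "(Im u)\<^sup>2 = 1"
    by (simp_all add: power2_eq_square algebra_simps)
  then have "u = \<i> \<or> u = - \<i>"
    by (auto simp: complex_eq_iff power2_eq_1_iff)
  moreover have "f \<i> = f 1 * u"
    using f1 by (simp add: u_def)
  moreover have "f z = Re z *\<^sub>R f 1 + Im z *\<^sub>R f \<i>" for z
  proof -
    have "z = Re z *\<^sub>R 1 + Im z *\<^sub>R \<i>"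
      by (simp add: complex_eq_iff)
    then have "f z = f (Re z *\<^sub>R 1 + Im z *\<^sub>R \<i>)"
      by (rule arg_cong)
    then show ?thesis
      by (simp only: linear_add[OF lin] linear_scale[OF lin])
  qed
  moreover have "Re z *\<^sub>R w + Im z *\<^sub>R (w * \<i>) = w * z"
    "Re z *\<^sub>R w + Im z *\<^sub>R (w * - \<i>) = w * cnj z" for w z
    by (simp_all add: complex_eq_iff algebra_simps)
  ultimately show ?thesis
    by metis
qed

text \<open>Such a map permutes the vertices. Being affine, it then fixes their centroid, which is 0
  because the roots of unity sum to 0; so it is a rotation or a reflection, and its factor \<open>a\<close> is
  the image of the vertex 1.\<close>

lemma regular_polygon_symmetry_cases:
  assumes n: "n > 1" and iso: "\<And>x y. dist (f x) (f y) = dist x y"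
    and img: "f ` regular_polygon n = regular_polygon n"
  obtains a where "a ^ n = 1" "f = (\<lambda>z. a * z) \<or> f = (\<lambda>z. a * cnj z)"
proof -
  let ?V = "{z :: complex. z ^ n = 1}"
  have fin: "finite ?V" and card: "card ?V = n"
    using n by (auto simp: finite_roots_unity card_roots_unity_eq)
  have inj: "inj_on f ?V"
    by (rule inj_onI) (metis iso dist_eq_0_iff)
  have "f ` ?V \<subseteq> ?V"
    using isometry_extreme_point[OF iso, of _ "regular_polygon n"]
      extreme_points_regular_polygon[of n] n unfolding img by auto
  then have fV: "f ` ?V = ?V"
    by (rule endo_inj_surj[OF fin _ inj])
  \<comment> \<open>\<open>g\<close> is the linear part of \<open>f\<close>; summing over the vertices yields \<open>n * f 0 = 0\<close>.\<close>
  define g where "g z = f z - f 0" for z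
  have "linear g"
    by (rule isometry_linear) (auto simp: g_def dist_norm iso[unfolded dist_norm])
  have "0 = (\<Sum>v\<in>?V. f v)"
    using sum_roots_unity[OF n] sum.reindex[OF inj, of "\<lambda>z. z"] by (simp add: fV)
  also have "\<dots> = (\<Sum>v\<in>?V. g v) + of_nat n * f 0"
    by (simp add: g_def sum_subtractf card)
  also have "(\<Sum>v\<in>?V. g v) = g (\<Sum>?V)"
    using linear_sum[OF \<open>linear g\<close>, of "\<lambda>z. z" ?V] by simp
  also have "\<dots> = 0"
    using sum_roots_unity[OF n] linear_0[OF \<open>linear g\<close>] by simp
  finally have "f 0 = 0"
    using n by simp
  moreover have "f 1 ^ n = 1"
    using fV by auto
  ultimately show thesis
    using isometry_eq_rotation_or_reflection[OF _ iso] that by blast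
qed

lemma regular_polygon_linear_image:
  assumes "n > 0" "linear f" "inj f" "\<And>z. z ^ n = 1 \<Longrightarrow> f z ^ n = 1"
  shows "f ` regular_polygon n = regular_polygon n"
proof -
  have "f ` {z. z ^ n = 1} = {z. z ^ n = 1}"
    using assms by (intro endo_inj_surj finite_roots_unity) (auto intro: inj_on_subset)
  then show ?thesis
    using assms by (simp add: regular_polygon_eq convex_hull_linear_image)
qed

lemma carrier_dihedral_group:
  assumes n: "n > 1"
  shows "carrier (dihedral_group n) =
    (\<lambda>a z. a * z) ` {a. a ^ n = 1} \<union> (\<lambda>a z. a * cnj z) ` {a. a ^ n = 1}" (is "_ = ?D")
proof
  show "carrier (dihedral_group n) \<subseteq> ?D"
  proof
    fix f assume "f \<in> carrier (dihedral_group n)"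
    then have "\<And>x y. dist (f x) (f y) = dist x y" "f ` regular_polygon n = regular_polygon n"
      by (auto simp: dihedral_group_def)
    then show "f \<in> ?D"
      using n by (elim regular_polygon_symmetry_cases[rotated 1]) auto
  qed
next
  have *: "f \<in> carrier (dihedral_group n)"
    if "linear f" "surj f" "\<And>z. norm (f z) = norm z" "\<And>z. z ^ n = 1 \<Longrightarrow> f z ^ n = 1" for f
  proof -
    have iso: "dist (f x) (f y) = dist x y" for x y
      using that(3)[of "x - y"] by (simp add: dist_norm linear_diff[OF that(1)])
    then have "inj f"
      by (metis injI dist_eq_0_iff)
    then show ?thesis
      using that n iso regular_polygon_linear_image[of n f]
      by (simp add: dihedral_group_def Bij_def bij_def)
  qed
  show "?D \<subseteq> carrier (dihedral_group n)"
  proof -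
    have "(\<lambda>z. a * z) \<in> carrier (dihedral_group n)"
      "(\<lambda>z. a * cnj z) \<in> carrier (dihedral_group n)" if a: "a ^ n = 1" for a
    proof -
      have na: "norm a = 1"
        using a n by (metis norm_one norm_power norm_ge_zero power_eq_1_iff not_one_less_zero)
      then have "a \<noteq> 0" by auto
      show "(\<lambda>z. a * z) \<in> carrier (dihedral_group n)"
        by (rule *) (auto simp: na a norm_mult power_mult_distrib linear_iff algebra_simps
            intro!: surjI[of _ "\<lambda>z. z / a"] simp: \<open>a \<noteq> 0\<close>)
      show "(\<lambda>z. a * cnj z) \<in> carrier (dihedral_group n)"
        by (rule *) (auto simp: na a norm_mult power_mult_distrib linear_iff algebra_simps
            intro!: surjI[of _ "\<lambda>z. cnj (z / a)"] simp: \<open>a \<noteq> 0\<close> simp flip: complex_cnj_power)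
    qed
    then show ?thesis by auto
  qed
qed

text \<open>The reflection in the line through 0 at angle \<open>\<pi> / n\<close>. Together with \<^const>\<open>cnj\<close>, the
  reflection in the real axis, it composes to the rotation by \<open>2 \<pi> / n\<close>.\<close>

definition polygon_reflection :: "nat \<Rightarrow> complex \<Rightarrow> complex" where
  "polygon_reflection n z = cis (2 * pi / real n) * cnj z"

lemma BijGroup_UNIV_mult:
  "f \<in> carrier (BijGroup UNIV) \<Longrightarrow> g \<in> carrier (BijGroup UNIV) \<Longrightarrow>
    f \<otimes>\<^bsub>BijGroup UNIV\<^esub> g = (\<lambda>x. f (g x))"
  by (rule ext) (simp add: BijGroup_mult_apply BijGroup_carrier)

text \<open>With \<open>\<omega> = cis (2 * pi / n)\<close>, the powers of the product of the two reflections are the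
  rotations \<open>z \<mapsto> \<omega>\<^sup>k z\<close>. They exhaust the rotations by \<open>n\<close>-th roots of unity, and composing
  them with \<^const>\<open>cnj\<close> gives the remaining symmetries.\<close>

lemma dihedral_group_generators:
  assumes n: "n > 2"
  shows "involution_pair (BijGroup UNIV) cnj (polygon_reflection n) n"
    and "dihedral_group n =
      BijGroup UNIV\<lparr>carrier := generate (BijGroup UNIV) {cnj, polygon_reflection n}\<rparr>"
proof -
  let ?G = "BijGroup (UNIV :: complex set)"
  let ?\<omega> = "cis (2 * pi / real n)" and ?t = "polygon_reflection n"
  interpret group ?G by (rule group_BijGroup)
  have root: "?\<omega> ^ n = 1"
    using n by (simp add: Complex.DeMoivre)
  have D: "cnj \<in> carrier (dihedral_group n)" "?t \<in> carrier (dihedral_group n)"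
  proof -
    have "cnj = (\<lambda>z. 1 * cnj z)" by simp
    then show "cnj \<in> carrier (dihedral_group n)"
      using n by (subst carrier_dihedral_group) (simp, blast intro: power_one)
    show "?t \<in> carrier (dihedral_group n)"
      using n root by (subst carrier_dihedral_group) (auto simp: polygon_reflection_def[abs_def])
  qed
  have sub: "carrier (dihedral_group n) \<subseteq> carrier ?G"
    by (auto simp: dihedral_group_def BijGroup_carrier)
  then have mem [simp]: "cnj \<in> carrier ?G" "?t \<in> carrier ?G"
    using D by auto
  have one: "\<one>\<^bsub>?G\<^esub> = (\<lambda>z. z)"
    by (simp add: BijGroup_def fun_eq_iff)
  have r: "?t \<otimes>\<^bsub>?G\<^esub> cnj = (\<lambda>z. ?\<omega> * z)"
    by (simp add: BijGroup_UNIV_mult polygon_reflection_def)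
  have pow: "(?t \<otimes>\<^bsub>?G\<^esub> cnj) [^]\<^bsub>?G\<^esub> k = (\<lambda>z. ?\<omega> ^ k * z)" for k :: nat
  proof (rule ext)
    fix z
    have "((\<lambda>z. ?\<omega> * z) ^^ k) z = ?\<omega> ^ k * z"
      by (induction k) (simp_all add: mult.assoc)
    then show "((?t \<otimes>\<^bsub>?G\<^esub> cnj) [^]\<^bsub>?G\<^esub> k) z = ?\<omega> ^ k * z"
      using m_closed[OF mem(2,1)] BijGroup_pow_apply[of "?t \<otimes>\<^bsub>?G\<^esub> cnj" UNIV z k]
      by (simp add: r BijGroup_carrier)
  qed
  have "?\<omega> ^ k = 1 \<longleftrightarrow> n dvd k" for k :: nat
  proof -
    have "?\<omega> ^ k = ?\<omega> ^ (k mod n)"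
      by (metis root div_mult_mod_eq power_add power_mult power_one mult_1 mult.commute)
    also have "\<dots> = 1 \<longleftrightarrow> k mod n = 0"
    proof -
      have "inj_on (\<lambda>k. cis (2 * pi * real k / real n)) {..<n}"
        using Complex.bij_betw_roots_unity[of n] n by (simp add: bij_betw_def)
      then have "cis (2 * pi * real (k mod n) / real n) = cis (2 * pi * real 0 / real n)
          \<longleftrightarrow> k mod n = 0"
        using n by (subst inj_on_eq_iff[where A = "{..<n}"]) auto
      then show ?thesis
        by (simp add: Complex.DeMoivre mult_ac)
    qed
    finally show ?thesis
      by (simp add: dvd_eq_mod_eq_0)
  qed
  then have ord: "ord (?t \<otimes>\<^bsub>?G\<^esub> cnj) = n"
    by (subst ord_unique) (simp_all add: pow one fun_eq_iff, metis)
  have "?\<omega> * (cnj ?\<omega> * z) = z" for z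
    by (simp add: cis_cnj cis_mult flip: mult.assoc)
  then have "?t \<otimes>\<^bsub>?G\<^esub> ?t = \<one>\<^bsub>?G\<^esub>"
    unfolding BijGroup_UNIV_mult[OF mem(2) mem(2)] one
    by (simp add: fun_eq_iff polygon_reflection_def)
  moreover have "cnj \<otimes>\<^bsub>?G\<^esub> cnj = \<one>\<^bsub>?G\<^esub>"
    unfolding BijGroup_UNIV_mult[OF mem(1) mem(1)] one by simp
  ultimately show pair: "involution_pair ?G cnj ?t n"
    using ord n by unfold_locales simp_all
  have "carrier (dihedral_group n) \<subseteq> generate ?G {cnj, ?t}"
  proof -
    have "(\<lambda>z. a * z) \<in> generate ?G {cnj, ?t}" "(\<lambda>z. a * cnj z) \<in> generate ?G {cnj, ?t}"
      if root_a: "a ^ n = 1" for a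
    proof -
      have "a \<in> (\<lambda>k. cis (2 * pi * real k / real n)) ` {..<n}"
        using bij_betw_imp_surj_on[OF Complex.bij_betw_roots_unity, of n] n root_a by simp
      then obtain k :: nat where "a = cis (2 * pi * real k / real n)"
        by blast
      then have a: "(\<lambda>z. a * z) = (?t \<otimes>\<^bsub>?G\<^esub> cnj) [^]\<^bsub>?G\<^esub> k"
        by (simp add: pow Complex.DeMoivre mult_ac)
      interpret involution_pair ?G cnj ?t n by (fact pair)
      have "(\<lambda>z. a * z) = word (int k, False)"
        by (simp add: a word_def int_pow_int)
      then show "(\<lambda>z. a * z) \<in> generate ?G {cnj, ?t}"
        by (simp add: generate_eq_words)
      have "(\<lambda>z. a * z) \<in> carrier ?G"
        unfolding a by simp
      then have "(\<lambda>z. a * cnj z) = (\<lambda>z. a * z) \<otimes>\<^bsub>?G\<^esub> cnj"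
        by (simp add: BijGroup_UNIV_mult)
      also have "\<dots> = word (int k, True)"
        by (simp add: a word_def int_pow_int)
      finally show "(\<lambda>z. a * cnj z) \<in> generate ?G {cnj, ?t}"
        by (simp add: generate_eq_words)
    qed
    then show ?thesis
      using n by (subst carrier_dihedral_group) auto
  qed
  moreover have "generate ?G {cnj, ?t} \<subseteq> carrier (dihedral_group n)"
  proof (rule generate_subgroup_incl)
    show "subgroup (carrier (dihedral_group n)) ?G"
      using sub group_dihedral_group[of n]
      by (intro group_incl_imp_subgroup) (simp_all add: dihedral_group_def)
  qed (use D in auto)
  ultimately have "carrier (dihedral_group n) = generate ?G {cnj, ?t}"
    by (rule subset_antisym)
  then show "dihedral_group n = ?G\<lparr>carrier := generate ?G {cnj, ?t}\<rparr>"
    by (simp add: dihedral_group_def)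
qed

theorem theorem5p1:
  shows "carrier PLR_group = generate Sym_triads {L_triad, R_triad} \<and>
    PLR_group \<cong> dihedral_group 12 \<and> Coset.order PLR_group = 24"
proof -
  interpret involution_pair Sym_triads L_triad R_triad 12
    by (rule involution_pair_L_R)
  have PLR: "PLR_group = Sym_triads\<lparr>carrier := generate Sym_triads {L_triad, R_triad}\<rparr>"
    by (simp add: PLR_group_def PLR_generate_eq)
  have "PLR_group \<cong> dihedral_group 12"
    using involution_pairs_iso[OF involution_pair_L_R dihedral_group_generators(1)]
    by (simp add: PLR dihedral_group_generators(2))
  then show ?thesis
    using card_generate by (simp add: PLR order_def)
qed

end
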